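(* Let $\{s_n^{M,N}(x)\}_{n\ge0}$ be the sequence of Sobolev-type polynomials orthonormal with respect to $\langle f,g\rangle_S=\int_Ef(x)g(x)\,d\mu+Mf(c)g(c)+Nf'(c)g'(c)$, and let $\{p_n^{[2]}(x)\}_{n\ge0}$ be the sequence of polynomials orthonormal with respect to $(x-c)^2d\mu$. Then $$s_n^{M,N}(x)=\gamma_{n,n}p_n^{[2]}(x)+\gamma_{n-1,n}p_{n-1}^{[2]}(x)+\gamma_{n-2,n}p_{n-2}^{[2]}(x),$$ where $$\gamma_{n,n}=\frac{t_n}{r_n^{[2]}}=\frac{t_n}{r_{n+1}}\left(\frac{K_{n+1}(c,c)}{K_n(c,c)}\right)^{1/2},$$ $$\gamma_{n-1,n}=-\left(\frac{K_{n-1}(c,c)}{K_n(c,c)}\right)^{1/2}\left(d_{n-1}\frac{t_n}{r_n}+e_{n-1}\frac{r_n}{r_{n-1}}\left[M\,s_n^{M,N}(c)p_{n-1}(c)+N\,[s_n^{M,N}]'(c)\,[p_{n-1}]'(c)\right]\right),$$ $$\gamma_{n-2,n}=\frac{r_{n-1}}{t_n}\left(\frac{K_{n-2}(c,c)}{K_{n-1}(c,c)}\right)^{1/2}.$$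
   Context: $\mu$ is a positive Borel measure with infinite support contained in an interval $E\subseteq\mathbb{R}$ (bounded or unbounded), with all moments finite; $c\in\mathbb{R}\setminus E$ and $M,N\ge0$. $\{P_n\}$ are the monic orthogonal polynomials with respect to $\mu$, $p_n(x)=r_nx^n+\cdots$ with $r_n>0$ the orthonormal ones, and $K_n(x,y)=\sum_{k=0}^np_k(x)p_k(y)$. $s_n^{M,N}(x)=t_nx^n+\cdots$ with $t_n>0$, and $p_n^{[2]}(x)=r_n^{[2]}x^n+\cdots$ with $r_n^{[2]}>0$. For $n\ge0$, $$d_n=\frac{P_{n+2}(c)P_n'(c)-P_{n+2}'(c)P_n(c)}{P_{n+1}(c)P_n'(c)-P_{n+1}'(c)P_n(c)},\qquad e_n=\frac{P_{n+2}(c)P_{n+1}'(c)-P_{n+2}'(c)P_{n+1}(c)}{P_{n+1}(c)P_n'(c)-P_{n+1}'(c)P_n(c)}.$$ Terms involving $p_{-1}^{[2]}$ or $p_{-2}^{[2]}$ are read as $0$ (when $n=0,1$). *)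

theory Defs
  imports "HOL-Analysis.Analysis" "HOL-Computational_Algebra.Polynomial"
begin

definition measure_support :: "'a::topological_space measure \<Rightarrow> 'a set" where
  "measure_support \<mu> = {x. \<forall>U. open U \<longrightarrow> x \<in> U \<longrightarrow> emeasure \<mu> U > 0}"

definition l2_form :: "real measure \<Rightarrow> real set \<Rightarrow> real poly \<Rightarrow> real poly \<Rightarrow> real" where
  "l2_form \<mu> E f g = (LINT x:E|\<mu>. poly f x * poly g x)"

definition christoffel_measure :: "real measure \<Rightarrow> real \<Rightarrow> real measure" where
  "christoffel_measure \<mu> c = density \<mu> (\<lambda>x. ennreal ((x - c)\<^sup>2))"

definition sobolev_form ::
    "real measure \<Rightarrow> real set \<Rightarrow> real \<Rightarrow> real \<Rightarrow> real \<Rightarrow> real poly \<Rightarrow> real poly \<Rightarrow> real" where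
  "sobolev_form \<mu> E c M N f g =
     (LINT x:E|\<mu>. poly f x * poly g x)
     + M * poly f c * poly g c + N * poly (pderiv f) c * poly (pderiv g) c"

definition monic_orthogonal_seq ::
    "(real poly \<Rightarrow> real poly \<Rightarrow> real) \<Rightarrow> (nat \<Rightarrow> real poly) \<Rightarrow> bool" where
  "monic_orthogonal_seq B P \<longleftrightarrow>
     (\<forall>n. degree (P n) = n \<and> lead_coeff (P n) = 1) \<and>
     (\<forall>m n. m \<noteq> n \<longrightarrow> B (P m) (P n) = 0)"

definition orthonormal_seq ::
    "(real poly \<Rightarrow> real poly \<Rightarrow> real) \<Rightarrow> (nat \<Rightarrow> real poly) \<Rightarrow> bool" where
  "orthonormal_seq B p \<longleftrightarrow>
     (\<forall>n. degree (p n) = n \<and> lead_coeff (p n) > 0) \<and>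
     (\<forall>m n. B (p m) (p n) = (if m = n then 1 else 0))"

definition cd_kernel :: "(nat \<Rightarrow> real poly) \<Rightarrow> nat \<Rightarrow> real \<Rightarrow> real \<Rightarrow> real" where
  "cd_kernel p n x y = (\<Sum>k\<le>n. poly (p k) x * poly (p k) y)"

definition coeff_d :: "(nat \<Rightarrow> real poly) \<Rightarrow> real \<Rightarrow> nat \<Rightarrow> real" where
  "coeff_d P c n =
     (poly (P (n + 2)) c * poly (pderiv (P n)) c - poly (pderiv (P (n + 2))) c * poly (P n) c)
     / (poly (P (n + 1)) c * poly (pderiv (P n)) c - poly (pderiv (P (n + 1))) c * poly (P n) c)"

definition coeff_e :: "(nat \<Rightarrow> real poly) \<Rightarrow> real \<Rightarrow> nat \<Rightarrow> real" where
  "coeff_e P c n =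
     (poly (P (n + 2)) c * poly (pderiv (P (n + 1))) c
        - poly (pderiv (P (n + 2))) c * poly (P (n + 1)) c)
     / (poly (P (n + 1)) c * poly (pderiv (P n)) c - poly (pderiv (P (n + 1))) c * poly (P n) c)"

end

theory Submission
  imports Defs
begin

text \<open>
  Put \<open>X = x - c\<close>. Multiplication by \<open>X\<^sup>2\<close> kills the point masses, so that the inner product of
  \<open>s n\<close> and \<open>p2 k\<close> with respect to \<open>X\<^sup>2 d\<mu>\<close> is both the Sobolev and the \<open>\<mu>\<close> inner product of
  \<open>s n\<close> and \<open>X\<^sup>2 p2 k\<close>. Sobolev orthogonality makes it vanish for \<open>k + 2 < n\<close> and gives its
  value for \<open>k + 2 = n\<close>. For \<open>k + 1 = n\<close>, one expands \<open>X\<^sup>2 p2 k\<close> as a multiple of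
  \<open>P (k + 2) - d k P (k + 1) + e k P k\<close>, where the double zero at \<open>c\<close> determines \<open>d k\<close> and \<open>e k\<close>.
  The kernels enter through \<open>X p2 n\<close>, which is the multiple of
  \<open>p (n + 1) - p (n + 1)(c) / K n c c \<cdot> K n (\<cdot>) c\<close> of norm one.
\<close>

section \<open>Orthonormal polynomials for an abstract symmetric bilinear form\<close>

locale orthonormal_polys =
  fixes B :: "real poly \<Rightarrow> real poly \<Rightarrow> real" and p :: "nat \<Rightarrow> real poly"
  assumes commute: "B f g = B g f"
    and add_left: "B (f + g) h = B f h + B g h"
    and smult_left: "B (smult a f) h = a * B f h"
    and orthonormal: "orthonormal_seq B p"
begin

lemma add_right: "B h (f + g) = B h f + B h g"
  using add_left commute by metis

lemma smult_right: "B h (smult a f) = a * B h f"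
  using smult_left commute by metis

lemma zero_left [simp]: "B 0 h = 0"
  using smult_left[of 0 0 h] by simp

lemma diff_left: "B (f - g) h = B f h - B g h"
  using add_left[of f "smult (-1) g" h] smult_left[of "-1" g h] by simp

lemma diff_right: "B h (f - g) = B h f - B h g"
  using diff_left commute by metis

lemma sum_left: "B (sum F A) h = (\<Sum>k\<in>A. B (F k) h)"
  by (induction A rule: infinite_finite_induct) (simp_all add: add_left)

lemma degree_p [simp]: "degree (p n) = n"
  using orthonormal by (simp add: orthonormal_seq_def)

lemma coeff_p_pos: "coeff (p n) n > 0"
  using orthonormal unfolding orthonormal_seq_def by (metis degree_p)

lemma form_p: "B (p m) (p n) = (if m = n then 1 else 0)"
  using orthonormal by (simp add: orthonormal_seq_def)

text \<open>Subtracting a multiple of \<open>p n\<close> removes the coefficient at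
  \<open>n\<close>, and induction does the rest. Bounding \<open>f\<close> by vanishing coefficients
  rather than by its degree makes the case \<open>n = 0\<close> say exactly that \<open>f\<close> is
  zero.\<close>

lemma expansion:
  assumes "\<And>i. i \<ge> n \<Longrightarrow> coeff f i = 0"
  shows "f = (\<Sum>k<n. smult (B f (p k)) (p k))"
  using assms
proof (induction n arbitrary: f)
  case 0
  then show ?case by (simp add: poly_eq_iff)
next
  case (Suc n)
  define a where "a = coeff f n / coeff (p n) n"
  define g where "g = f - smult a (p n)"
  have "coeff g i = 0" if "i \<ge> n" for i
    using that Suc.prems[of i] coeff_p_pos[of n]
    by (cases "i = n") (simp_all add: g_def a_def coeff_eq_0)
  then have g: "g = (\<Sum>k<n. smult (B g (p k)) (p k))"
    by (rule Suc.IH)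
  \<comment> \<open>The remainder \<open>g\<close> is a combination of \<open>p k\<close> with
    \<open>k < n\<close>, so the removed multiple \<open>a\<close> is itself the Fourier coefficient
    of \<open>f\<close> at \<open>p n\<close>.\<close>
  have "B g (p n) = 0"
    by (subst g) (simp add: sum_left smult_left form_p)
  then have fn: "B f (p n) = a"
    by (simp add: g_def diff_left smult_left form_p)
  have "B g (p k) = B f (p k)" if "k < n" for k
    using that by (simp add: g_def diff_left smult_left form_p)
  then have "g = (\<Sum>k<n. smult (B f (p k)) (p k))"
    using g by simp
  then show ?case
    using fn by (simp add: g_def algebra_simps)
qed

lemma form_p_degree_less:
  assumes "degree f < n"
  shows "B f (p n) = 0"
proof -
  have f: "f = (\<Sum>k<n. smult (B f (p k)) (p k))"
    by (rule expansion) (use assms in \<open>auto intro: coeff_eq_0\<close>)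
  show ?thesis
    by (subst f) (simp add: sum_left smult_left form_p)
qed

lemma form_p_degree_le:
  assumes "degree f \<le> n"
  shows "B f (p n) = coeff f n / coeff (p n) n"
proof -
  have f: "f = (\<Sum>k<Suc n. smult (B f (p k)) (p k))"
    by (rule expansion) (use assms in \<open>auto intro: coeff_eq_0\<close>)
  have "coeff f n = (\<Sum>k<Suc n. B f (p k) * coeff (p k) n)"
    by (subst f) (simp add: coeff_sum)
  also have "\<dots> = B f (p n) * coeff (p n) n"
    by (simp add: coeff_eq_0)
  finally show ?thesis
    using coeff_p_pos[of n] by (simp add: field_simps)
qed

text \<open>Definiteness is not a locale assumption: it follows from Parseval's identity, which
  makes \<open>B f f\<close> a finite sum of squares of Fourier coefficients.\<close>

lemma form_definite:
  assumes "B f f = 0"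
  shows "f = 0"
proof -
  let ?n = "Suc (degree f)"
  have f: "f = (\<Sum>k<?n. smult (B f (p k)) (p k))"
    by (rule expansion) (auto intro: coeff_eq_0)
  have "B f h = (\<Sum>k<?n. B f (p k) * B h (p k))" for h
    unfolding commute[of h] by (subst f) (simp only: sum_left smult_left)
  from this[of f] have "B f f = (\<Sum>k<?n. (B f (p k))\<^sup>2)"
    by (simp only: power2_eq_square)
  then have "\<forall>k\<in>{..<?n}. (B f (p k))\<^sup>2 = 0"
    using assms by (subst sum_nonneg_eq_0_iff[symmetric]) auto
  then have "(\<Sum>k<?n. smult (B f (p k)) (p k)) = 0"
    by (intro sum.neutral) simp
  with f show ?thesis by simp
qed

text \<open>Only the top term of the expansion survives. This is the tool for recognising a quotient
  by a power of \<open>x - c\<close> as a multiple of \<open>p2 n\<close>.\<close>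

lemma orthogonal_imp_smult:
  assumes "degree g \<le> n" and "\<And>q. degree q < n \<Longrightarrow> B g q = 0"
  shows "g = smult (coeff g n / coeff (p n) n) (p n)"
proof -
  have "g = (\<Sum>k<Suc n. smult (B g (p k)) (p k))"
    by (rule expansion) (use assms in \<open>auto intro: coeff_eq_0\<close>)
  also have "\<dots> = smult (B g (p n)) (p n)"
    using assms(2) by simp
  finally show ?thesis
    using form_p_degree_le[OF assms(1)] by simp
qed

text \<open>By strong induction each earlier \<open>p k\<close> is a multiple of \<open>P k\<close>,
  so \<open>P n\<close> is orthogonal to all of them and only the component along \<open>p n\<close>
  remains.\<close>

lemma monic_orthogonal_eq:
  assumes "monic_orthogonal_seq B P"
  shows "P n = smult (1 / coeff (p n) n) (p n)"
proof -
  have deg: "degree (P n) = n" and lead: "coeff (P n) n = 1" for n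
    using assms unfolding monic_orthogonal_seq_def by metis+
  have orth: "B (P m) (P n) = 0" if "m \<noteq> n" for m n
    using assms that by (simp add: monic_orthogonal_seq_def)
  show ?thesis
  proof (induction n rule: less_induct)
    case (less n)
    have *: "B (P n) (p k) = 0" if "k < n" for k
    proof -
      have "p k = smult (coeff (p k) k) (P k)"
        using less.IH[OF that] coeff_p_pos[of k] by simp
      then have "B (P n) (p k) = coeff (p k) k * B (P n) (P k)"
        by (metis smult_right)
      then show ?thesis
        using that by (simp add: orth)
    qed
    have "P n = (\<Sum>k<Suc n. smult (B (P n) (p k)) (p k))"
      by (rule expansion) (auto intro: coeff_eq_0 simp: deg)
    then have "P n = smult (B (P n) (p n)) (p n)"
      using * by simp
    then show ?case
      using form_p_degree_le[of "P n" n] by (simp add: deg lead)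
  qed
qed

end

section \<open>Splitting off linear factors\<close>

lemma degree_linear_factor_mult:
  fixes q :: "'a::idom poly"
  assumes "q \<noteq> 0"
  shows "degree ([:- c, 1:] * q) = Suc (degree q)"
  using assms by (subst degree_mult_eq) auto

lemma coeff_linear_factor_mult:
  fixes q :: "'a::idom poly"
  assumes "degree q \<le> n"
  shows "coeff ([:- c, 1:] * q) (Suc n) = coeff q n"
  using assms by (simp add: coeff_eq_0)

text \<open>If \<open>f\<close> is \<open>x - c\<close> times \<open>h\<close>, the product rule
  gives f'(c) = h(c), so the factor can be split off a second time.\<close>

lemma double_root_factor:
  fixes f :: "'a::idom poly"
  assumes "poly f c = 0" and "poly (pderiv f) c = 0"
  obtains g where "f = [:- c, 1:] * ([:- c, 1:] * g)"
proof -
  obtain h where h: "f = [:- c, 1:] * h"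
    using assms(1) by (auto simp: poly_eq_0_iff_dvd elim: dvdE)
  have "poly h c = 0"
    using assms(2) unfolding h pderiv_mult by (simp add: pderiv_pCons)
  then obtain g where "h = [:- c, 1:] * g"
    by (auto simp: poly_eq_0_iff_dvd elim: dvdE)
  with h that show thesis by blast
qed

section \<open>The Christoffel transform by the square of \<open>x - c\<close>\<close>

locale christoffel_polys = orthonormal_polys B p + two: orthonormal_polys B2 p2
  for B B2 :: "real poly \<Rightarrow> real poly \<Rightarrow> real" and p p2 :: "nat \<Rightarrow> real poly" +
  fixes c :: real
  assumes form_mult: "B (h * f) g = B f (h * g)"
    and form2: "B2 f g = B ([:- c, 1:] * f) ([:- c, 1:] * g)"
begin

lemma form2_square: "B2 f g = B f ([:- c, 1:] * ([:- c, 1:] * g))"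
  unfolding form2 by (rule form_mult)

text \<open>The summand of index 0 is the square of a nonzero constant.\<close>

lemma kernel_pos: "cd_kernel p n c c > 0"
proof -
  obtain a where a: "p 0 = [:a:]"
    using degree_p[of 0] by (blast elim: degree_eq_zeroE)
  with coeff_p_pos[of 0] have "a \<noteq> 0" by auto
  then have "0 < poly (p 0) c * poly (p 0) c"
    by (simp add: a zero_less_mult_iff) linarith
  also have "\<dots> \<le> cd_kernel p n c c"
    unfolding cd_kernel_def by (intro member_le_sum) auto
  finally show ?thesis .
qed

lemma lead_coeff_christoffel:
  "coeff (p2 n) n = coeff (p (Suc n)) (Suc n) * sqrt (cd_kernel p n c c / cd_kernel p (Suc n) c c)"
proof -
  define K where "K = cd_kernel p n c c"
  \<comment> \<open>This is the kernel with second argument fixed at \<open>c\<close>; the multiple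
    of it subtracted in \<open>h\<close> is chosen to give \<open>h\<close> a zero at
    \<open>c\<close>.\<close>
  define k where "k = (\<Sum>j\<le>n. smult (poly (p j) c) (p j))"
  define h where "h = p (Suc n) - smult (poly (p (Suc n)) c / K) k"
  have K: "K > 0" by (simp add: K_def kernel_pos)
  have kc: "poly k c = K"
    by (simp add: k_def K_def cd_kernel_def poly_sum)
  have deg_k: "degree k \<le> n"
    unfolding k_def by (rule degree_sum_le) (auto intro: order_trans[OF degree_smult_le])
  have reproducing: "B k q = poly q c" if "degree q \<le> n" for q
  proof -
    have q: "q = (\<Sum>j<Suc n. smult (B q (p j)) (p j))"
      by (rule expansion) (use that in \<open>auto intro: coeff_eq_0\<close>)
    have "poly q c = (\<Sum>j<Suc n. B q (p j) * poly (p j) c)"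
      by (subst q) (simp add: poly_sum)
    also have "\<dots> = B k q"
      unfolding k_def lessThan_Suc_atMost commute[of q]
      by (simp add: sum_left smult_left mult.commute)
    finally show ?thesis by simp
  qed
  have hc: "poly h c = 0"
    using K by (simp add: h_def kc)
  then obtain g where g: "h = [:- c, 1:] * g"
    by (auto simp: poly_eq_0_iff_dvd elim: dvdE)
  have deg_h: "degree h \<le> Suc n"
    unfolding h_def by (intro degree_diff_le order_trans[OF degree_smult_le]) (use deg_k in auto)
  have deg_g: "degree g \<le> n"
    using deg_h degree_linear_factor_mult[of g c] by (cases "g = 0") (auto simp: g)
  have coeff_g: "coeff g n = coeff (p (Suc n)) (Suc n)"
    using coeff_linear_factor_mult[OF deg_g, of c] deg_k
    unfolding g[symmetric] by (simp add: h_def coeff_eq_0)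
  \<comment> \<open>Against \<open>x - c\<close> times \<open>q\<close>, the term
    \<open>p (Suc n)\<close> contributes nothing for degree reasons, and the kernel returns the
    value at \<open>c\<close>, which is zero.\<close>
  have orth: "B2 g q = 0" if "degree q < n" for q
  proof -
    have dq: "degree ([:- c, 1:] * q) \<le> n"
      using that degree_linear_factor_mult[of q c] by (cases "q = 0") auto
    have "B2 g q = B h ([:- c, 1:] * q)"
      by (simp add: form2 g)
    also have "\<dots> = B ([:- c, 1:] * q) (p (Suc n)) - poly (p (Suc n)) c / K * B k ([:- c, 1:] * q)"
      unfolding h_def by (simp only: diff_left smult_left commute[of "p (Suc n)"])
    also have "\<dots> = 0"
      using form_p_degree_less[of "[:- c, 1:] * q" "Suc n"] reproducing[OF dq] dq by simp
    finally show ?thesis .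
  qed
  define a where "a = coeff g n / coeff (p2 n) n"
  have g2: "g = smult a (p2 n)"
    unfolding a_def by (rule two.orthogonal_imp_smult[OF deg_g orth])
  \<comment> \<open>Since \<open>k\<close> is orthogonal to \<open>p (Suc n)\<close> and has squared
    norm \<open>K\<close>, Pythagoras yields the squared norm of \<open>h\<close>.\<close>
  have kp: "B k (p (Suc n)) = 0"
    by (rule form_p_degree_less) (use deg_k in simp)
  have "a\<^sup>2 = B2 g g"
    by (simp add: g2 two.smult_left two.smult_right two.form_p power2_eq_square)
  also have "\<dots> = B h h"
    by (simp only: form2 g)
  also have "\<dots> = 1 + (poly (p (Suc n)) c / K)\<^sup>2 * K"
    using reproducing[OF deg_k] kp commute[of "p (Suc n)" k]
    by (simp add: h_def diff_left diff_right smult_left smult_right form_p kc power2_eq_square)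
  also have "\<dots> = cd_kernel p (Suc n) c c / K"
    using K by (simp add: cd_kernel_def K_def[symmetric] power2_eq_square field_simps)
      (simp add: K_def cd_kernel_def)
  finally have a2: "a\<^sup>2 = cd_kernel p (Suc n) c c / K" .
  \<comment> \<open>Positive leading coefficients select the positive square root.\<close>
  have a: "a > 0"
    using coeff_p_pos two.coeff_p_pos by (simp add: a_def coeff_g)
  then have "a = sqrt (cd_kernel p (Suc n) c c / K)"
    using a2 by (simp add: real_sqrt_unique)
  then have "sqrt (K / cd_kernel p (Suc n) c c) = 1 / a"
    by (simp add: real_sqrt_divide)
  then show ?thesis
    using a two.coeff_p_pos[of n] coeff_p_pos[of "Suc n"]
    by (simp add: K_def[symmetric] a_def coeff_g)
qed

text \<open>If the Wronskian vanished, some nontrivial combination of \<open>p n\<close> and \<open>p (n + 1)\<close> would be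
  \<open>X\<^sup>2 q\<close> with \<open>degree q < n\<close>, and orthogonality to \<open>q\<close> would give \<open>X q\<close> norm zero.\<close>

lemma wronskian_nonzero:
  "poly (p (Suc n)) c * poly (pderiv (p n)) c - poly (pderiv (p (Suc n))) c * poly (p n) c \<noteq> 0"
proof
  assume W: "poly (p (Suc n)) c * poly (pderiv (p n)) c
    - poly (pderiv (p (Suc n))) c * poly (p n) c = 0"
  \<comment> \<open>A kernel vector of a singular 2 by 2 matrix: the row of values supplies it
    unless that row is zero, in which case the row of derivatives does, and if
    \<open>pderiv (p n)\<close> also vanishes at \<open>c\<close> the vector (0, 1) works.\<close>
  obtain u v :: real where uv: "u \<noteq> 0 \<or> v \<noteq> 0"
    and 1: "u * poly (p (Suc n)) c + v * poly (p n) c = 0"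
    and 2: "u * poly (pderiv (p (Suc n))) c + v * poly (pderiv (p n)) c = 0"
  proof (cases "poly (p n) c = 0 \<and> poly (p (Suc n)) c = 0")
    case True
    show thesis
    proof (cases "poly (pderiv (p n)) c = 0")
      case True
      with \<open>poly (p n) c = 0 \<and> _\<close> show thesis by (intro that[of 0 1]) auto
    next
      case False
      with True show thesis
        by (intro that[of "poly (pderiv (p n)) c" "- poly (pderiv (p (Suc n))) c"]) auto
    qed
  next
    case False
    with W show thesis
      by (intro that[of "poly (p n) c" "- poly (p (Suc n)) c"]) (auto simp: algebra_simps)
  qed
  define f where "f = smult u (p (Suc n)) + smult v (p n)"
  have "poly f c = 0" "poly (pderiv f) c = 0"
    using 1 2 by (simp_all add: f_def pderiv_add pderiv_smult)
  then obtain q where q: "f = [:- c, 1:] * ([:- c, 1:] * q)"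
    by (rule double_root_factor)
  have "degree f \<le> Suc n"
    unfolding f_def by (intro degree_add_le order_trans[OF degree_smult_le]) auto
  \<comment> \<open>Two linear factors cost two degrees; for \<open>n = 0\<close> only
    \<open>q = 0\<close> is left.\<close>
  then have "q = 0 \<or> degree q < n"
    using degree_linear_factor_mult[of q c] degree_linear_factor_mult[of "[:- c, 1:] * q" c]
    by (cases "q = 0") (auto simp: q simp del: mult_pCons_left)
  then have "B q f = 0"
    using form_p_degree_less[of q n] form_p_degree_less[of q "Suc n"]
    by (auto simp: f_def add_right smult_right)
  then have "B2 q q = 0"
    by (simp only: form2_square q)
  then have "q = 0"
    by (rule two.form_definite)
  then have "f = 0"
    by (simp add: q)
  \<comment> \<open>These two products are \<open>v\<close> and \<open>u\<close>, which do not both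
    vanish.\<close>
  then have "B f (p n) = 0" "B f (p (Suc n)) = 0" by simp_all
  then show False
    using uv by (simp add: f_def add_left smult_left form_p)
qed

text \<open>\<open>coeff_d\<close> and \<open>coeff_e\<close> are the Cramer solution of the two
  equations giving the bracket a double zero at \<open>c\<close>. The bracket is orthogonal to all
  degrees below \<open>n\<close>, so its quotient by the double factor is monic and orthogonal for
  \<open>B2\<close>.\<close>

lemma square_mult_christoffel:
  assumes P: "monic_orthogonal_seq B P"
  shows "[:- c, 1:] * ([:- c, 1:] * p2 n) =
    smult (coeff (p2 n) n) (P (n + 2) - smult (coeff_d P c n) (P (n + 1)) + smult (coeff_e P c n) (P n))"
proof -
  have deg: "degree (P n) = n" and lead: "coeff (P n) n = 1" for n
    using P unfolding monic_orthogonal_seq_def by metis+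
  note Pp = monic_orthogonal_eq[OF P]
  define F where "F = P (n + 2) - smult (coeff_d P c n) (P (n + 1)) + smult (coeff_e P c n) (P n)"
  define W where "W = poly (P (n + 1)) c * poly (pderiv (P n)) c
    - poly (pderiv (P (n + 1))) c * poly (P n) c"
  have "W = 1 / coeff (p n) n * (1 / coeff (p (Suc n)) (Suc n)) *
    (poly (p (Suc n)) c * poly (pderiv (p n)) c - poly (pderiv (p (Suc n))) c * poly (p n) c)"
    unfolding W_def by (simp add: Pp pderiv_smult algebra_simps)
  then have W: "W \<noteq> 0"
    using wronskian_nonzero[of n] coeff_p_pos[of n] coeff_p_pos[of "Suc n"] by simp
  have d: "W * coeff_d P c n = poly (P (n + 2)) c * poly (pderiv (P n)) c
      - poly (pderiv (P (n + 2))) c * poly (P n) c"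
    and e: "W * coeff_e P c n = poly (P (n + 2)) c * poly (pderiv (P (n + 1))) c
      - poly (pderiv (P (n + 2))) c * poly (P (n + 1)) c"
    using W unfolding coeff_d_def coeff_e_def W_def[symmetric] by simp_all
  \<comment> \<open>Scaling by \<open>W\<close> lets \<open>d\<close> and \<open>e\<close> be
    substituted without denominators.\<close>
  have "W * poly F c = W * poly (P (n + 2)) c - (W * coeff_d P c n) * poly (P (n + 1)) c
      + (W * coeff_e P c n) * poly (P n) c"
    by (simp add: F_def algebra_simps)
  moreover have "W * poly (pderiv F) c = W * poly (pderiv (P (n + 2))) c
      - (W * coeff_d P c n) * poly (pderiv (P (n + 1))) c
      + (W * coeff_e P c n) * poly (pderiv (P n)) c"
    by (simp add: F_def pderiv_add pderiv_diff pderiv_smult algebra_simps)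
  ultimately have "W * poly F c = 0" "W * poly (pderiv F) c = 0"
    unfolding d e by (simp_all add: W_def algebra_simps)
  then have "poly F c = 0" "poly (pderiv F) c = 0"
    using W by simp_all
  then obtain g where g: "F = [:- c, 1:] * ([:- c, 1:] * g)"
    by (rule double_root_factor)
  have degF: "degree F \<le> n + 2"
    unfolding F_def
    by (intro degree_add_le degree_diff_le order_trans[OF degree_smult_le]) (auto simp: deg)
  have deg_g: "degree g \<le> n"
    using degF degree_linear_factor_mult[of g c] degree_linear_factor_mult[of "[:- c, 1:] * g" c]
    by (cases "g = 0") (auto simp: g simp del: mult_pCons_left)
  have "coeff F (Suc (Suc n)) = coeff g n"
  proof -
    have "degree ([:- c, 1:] * g) \<le> Suc n"
      using deg_g degree_linear_factor_mult[of g c] by (cases "g = 0") auto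
    then show ?thesis
      using deg_g unfolding g by (simp only: coeff_linear_factor_mult)
  qed
  then have coeff_g: "coeff g n = 1"
    using lead[of "Suc (Suc n)"] by (simp add: F_def deg coeff_eq_0)
  have "B2 g q = 0" if "degree q < n" for q
  proof -
    have "B2 g q = B q F"
      unfolding g by (subst two.commute) (rule form2_square)
    then show ?thesis
      using that
      by (simp add: F_def Pp diff_right add_right smult_right form_p_degree_less)
  qed
  from two.orthogonal_imp_smult[OF deg_g this]
  have "g = smult (1 / coeff (p2 n) n) (p2 n)"
    by (simp add: coeff_g)
  then have "p2 n = smult (coeff (p2 n) n) g"
    using two.coeff_p_pos[of n] by simp
  then show ?thesis
    unfolding F_def[symmetric] g by (metis mult_smult_right)
qed

end

section \<open>The integral forms and the connection coefficients\<close>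

lemma integrable_poly:
  fixes \<mu> :: "real measure"
  assumes "\<And>k::nat. integrable \<mu> (\<lambda>x. x ^ k)"
  shows "integrable \<mu> (poly f)"
proof -
  have "integrable \<mu> (\<lambda>x. \<Sum>i\<le>degree f. coeff f i * x ^ i)"
    using assms by (intro Bochner_Integration.integrable_sum integrable_mult_right)
  then show ?thesis
    by (simp add: poly_altdef[abs_def])
qed

theorem theorem1:
  fixes \<mu> :: "real measure" and E :: "real set" and c M N :: real
    and P p s p2 :: "nat \<Rightarrow> real poly"
    and r t r2 :: "nat \<Rightarrow> real" and K :: "nat \<Rightarrow> real \<Rightarrow> real \<Rightarrow> real" and d e :: "nat \<Rightarrow> real"
  assumes borel: "sets \<mu> = sets borel"
    and interval: "is_interval E"
    and supp_subset: "measure_support \<mu> \<subseteq> E"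
    and supp_infinite: "infinite (measure_support \<mu>)"
    and moments: "\<And>k::nat. integrable \<mu> (\<lambda>x. x ^ k)"
    and c: "c \<notin> E" and M: "M \<ge> 0" and N: "N \<ge> 0"
    and P: "monic_orthogonal_seq (l2_form \<mu> E) P"
    and p: "orthonormal_seq (l2_form \<mu> E) p"
    and s: "orthonormal_seq (sobolev_form \<mu> E c M N) s"
    and p2: "orthonormal_seq (l2_form (christoffel_measure \<mu> c) E) p2"
  defines "r \<equiv> \<lambda>n. lead_coeff (p n)"
    and "t \<equiv> \<lambda>n. lead_coeff (s n)"
    and "r2 \<equiv> \<lambda>n. lead_coeff (p2 n)"
    and "K \<equiv> cd_kernel p"
    and "d \<equiv> coeff_d P c"
    and "e \<equiv> coeff_e P c"
  shows "\<exists>\<gamma> :: nat \<Rightarrow> nat \<Rightarrow> real. \<forall>n.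
    (\<forall>x. poly (s n) x =
        \<gamma> n n * poly (p2 n) x
        + (if n \<ge> 1 then \<gamma> (n - 1) n * poly (p2 (n - 1)) x else 0)
        + (if n \<ge> 2 then \<gamma> (n - 2) n * poly (p2 (n - 2)) x else 0)) \<and>
    \<gamma> n n = t n / r2 n \<and>
    \<gamma> n n = t n / r (n + 1) * sqrt (K (n + 1) c c / K n c c) \<and>
    (n \<ge> 1 \<longrightarrow> \<gamma> (n - 1) n =
        - sqrt (K (n - 1) c c / K n c c) *
          (d (n - 1) * (t n / r n)
           + e (n - 1) * (r n / r (n - 1)) *
             (M * poly (s n) c * poly (p (n - 1)) c
              + N * poly (pderiv (s n)) c * poly (pderiv (p (n - 1))) c))) \<and>
    (n \<ge> 2 \<longrightarrow> \<gamma> (n - 2) n =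
        r (n - 1) / t n * sqrt (K (n - 2) c c / K (n - 1) c c))"
proof -
  define B where "B = l2_form \<mu> E"
  define B2 where "B2 = l2_form (christoffel_measure \<mu> c) E"
  define S where "S = sobolev_form \<mu> E c M N"
  have E: "E \<in> sets \<mu>"
    using real_interval_borel_measurable[OF interval] borel by simp
  \<comment> \<open>With a single polynomial as integrand, ring identities between polynomials yield
    commutativity and \<open>form_mult\<close>.\<close>
  have B_eq: "B f g = (LINT x:E|\<mu>. poly (f * g) x)" for f g
    by (simp add: B_def l2_form_def)
  have int: "set_integrable \<mu> E (poly f)" for f
    unfolding set_integrable_def using integrable_poly[OF moments, of f] E
    by (rule integrable_mult_indicator[rotated])
  have B_add: "B (f + g) h = B f h + B g h" for f g h
    using set_integral_add(2)[OF int[of "f * h"] int[of "g * h"]]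
    by (simp add: B_eq distrib_right)
  have B_smult: "B (smult a f) h = a * B f h" for a f h
    by (simp add: B_eq mult.assoc)
  have B_commute: "B f g = B g f" for f g
    by (simp add: B_eq mult.commute)
  \<comment> \<open>The density is a square, so each argument takes one factor
    \<open>x - c\<close>.\<close>
  have B2_eq: "B2 f g = B ([:- c, 1:] * f) ([:- c, 1:] * g)" for f g
  proof -
    have 1: "(\<lambda>x. indicator E x *\<^sub>R (poly f x * poly g x)) \<in> borel_measurable \<mu>"
      using int[of "f * g"] by (simp add: set_integrable_def borel_measurable_integrable)
    have 2: "(\<lambda>x. (x - c)\<^sup>2) \<in> borel_measurable \<mu>"
      using borel by (simp cong: measurable_cong_sets)
    show ?thesis
      unfolding B2_def B_def l2_form_def christoffel_measure_def set_lebesgue_integral_def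
      by (subst integral_density[OF 1 2])
        (simp_all add: power2_eq_square ac_simps del: mult_pCons_left, simp add: algebra_simps)
  qed
  have S_eq: "S f g = B f g + M * poly f c * poly g c
      + N * poly (pderiv f) c * poly (pderiv g) c" for f g
    by (simp add: S_def sobolev_form_def B_def l2_form_def)
  interpret christoffel_polys B B2 p p2 c
  proof unfold_locales
    show "orthonormal_seq B p" "orthonormal_seq B2 p2"
      using p p2 by (simp_all add: B_def B2_def)
    show "B (h * f) g = B f (h * g)" for f g h
      by (simp add: B_eq algebra_simps)
    show "B2 (f + g) h = B2 f h + B2 g h" for f g h
      unfolding B2_eq distrib_left B_add ..
    show "B2 (smult a f) h = a * B2 f h" for a f h
      unfolding B2_eq mult_smult_right B_smult ..
    show "B2 f g = B2 g f" for f g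
      unfolding B2_eq by (rule B_commute)
  qed (fact B_commute B_add B_smult B2_eq)+
  interpret sob: orthonormal_polys S s
  proof unfold_locales
    show "orthonormal_seq S s"
      using s by (simp add: S_def)
    show "S f g = S g f" for f g
      using B_commute[of f g] by (simp add: S_eq)
  qed (simp_all add: S_eq B_add B_smult pderiv_add pderiv_smult algebra_simps)
  have PB: "monic_orthogonal_seq B P"
    using P by (simp add: B_def)
  define X where "X = [:- c, 1:]"
  have S_square: "B2 f g = S f (X * (X * g))" for f g
    by (simp add: S_eq form2_square X_def pderiv_mult del: mult_pCons_left)
  have p2_nz: "p2 k \<noteq> 0" for k
    using two.coeff_p_pos[of k] by auto
  have deg1: "degree (X * p2 k) = Suc k" for k
    using p2_nz by (simp add: X_def degree_linear_factor_mult del: mult_pCons_left)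
  then have deg_square: "degree (X * (X * p2 k)) = Suc (Suc k)" for k
    using degree_linear_factor_mult[of "X * p2 k" c] by (metis X_def Zero_not_Suc degree_0)
  have coeff_square: "coeff (X * (X * p2 k)) (Suc (Suc k)) = r2 k" for k
    unfolding X_def r2_def using deg1[of k]
    by (simp only: coeff_linear_factor_mult X_def two.degree_p order_refl)
  have Kpos: "K k c c > 0" for k
    unfolding K_def by (rule kernel_pos)
  have rpos: "r k > 0" and tpos: "t k > 0" and r2pos: "r2 k > 0" for k
    unfolding r_def t_def r2_def
    by (simp_all add: coeff_p_pos sob.coeff_p_pos two.coeff_p_pos)
  have r2_eq: "r2 k = r (Suc k) * sqrt (K k c c / K (Suc k) c c)" for k
    using lead_coeff_christoffel[of k] by (simp add: r_def r2_def K_def)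
  have lead: "B2 (s n) (p2 n) = t n / r2 n" for n
    using two.form_p_degree_le[of "s n" n] by (simp add: t_def r2_def)
  have low: "B2 (s n) (p2 k) = 0" if "k + 2 < n" for k n
    using sob.form_p_degree_less[of "X * (X * p2 k)" n] that
    by (simp add: S_square sob.commute[of "s n"] deg_square)
  \<comment> \<open>The polynomial \<open>X * (X * p2 k)\<close> has degree exactly
    \<open>k + 2\<close> and leading coefficient \<open>r2 k\<close>, hence its component along
    \<open>s (k + 2)\<close> is a quotient of leading coefficients.\<close>
  have second: "B2 (s (k + 2)) (p2 k) = r2 k / t (k + 2)" for k
    using sob.form_p_degree_le[of "X * (X * p2 k)" "k + 2"] coeff_square[of k]
    by (simp add: S_square sob.commute[of "s _"] deg_square t_def)
  have first: "B2 (s (Suc m)) (p2 m) = - sqrt (K m c c / K (Suc m) c c) *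
      (d m * (t (Suc m) / r (Suc m)) + e m * (r (Suc m) / r m) *
        (M * poly (s (Suc m)) c * poly (p m) c
         + N * poly (pderiv (s (Suc m))) c * poly (pderiv (p m)) c))" for m
  proof -
    define Q where "Q = M * poly (s (Suc m)) c * poly (p m) c
         + N * poly (pderiv (s (Suc m))) c * poly (pderiv (p m)) c"
    have Pp: "P k = smult (1 / r k) (p k)" for k
      using monic_orthogonal_eq[OF PB] by (simp add: r_def)
    have "B (s (Suc m)) (p (m + 2)) = 0"
      by (rule form_p_degree_less) simp
    moreover have "B (s (Suc m)) (p (m + 1)) = t (Suc m) / r (Suc m)"
      using form_p_degree_le[of "s (Suc m)" "Suc m"] by (simp add: t_def r_def)
    \<comment> \<open>Sobolev orthogonality of \<open>s (Suc m)\<close> to the lower degree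
      polynomial \<open>p m\<close> leaves minus the point mass terms.\<close>
    moreover have "B (s (Suc m)) (p m) = - Q"
      using sob.form_p_degree_less[of "p m" "Suc m"]
      by (simp add: B_commute[of "p m"] S_eq Q_def algebra_simps)
    moreover have "B2 (s (Suc m)) (p2 m) =
        B (s (Suc m)) (smult (r2 m) (P (m + 2) - smult (d m) (P (m + 1)) + smult (e m) (P m)))"
      unfolding form2_square square_mult_christoffel[OF PB] by (simp add: r2_def d_def e_def)
    ultimately have "B2 (s (Suc m)) (p2 m) =
        r2 m * (- d m * (t (Suc m) / (r (Suc m))\<^sup>2) - e m * Q / r m)"
      by (simp add: Pp smult_right add_right diff_right power2_eq_square)
    also have "\<dots> = - sqrt (K m c c / K (Suc m) c c) *
      (d m * (t (Suc m) / r (Suc m)) + e m * (r (Suc m) / r m) * Q)"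
      using rpos[of m] rpos[of "Suc m"] unfolding r2_eq
      by (simp add: field_simps power2_eq_square)
    finally show ?thesis
      by (simp add: Q_def)
  qed
  have exp: "poly (s n) x = (\<Sum>k<Suc n. B2 (s n) (p2 k) * poly (p2 k) x)" for n x
  proof -
    have "s n = (\<Sum>k<Suc n. smult (B2 (s n) (p2 k)) (p2 k))"
      by (rule two.expansion) (auto intro: coeff_eq_0)
    then have "poly (s n) x = poly (\<Sum>k<Suc n. smult (B2 (s n) (p2 k)) (p2 k)) x"
      by (rule arg_cong)
    then show ?thesis
      by (simp add: poly_sum)
  qed
  show ?thesis
  \<comment> \<open>The witness consists of the Fourier coefficients of \<open>s n\<close> with
    respect to \<open>p2\<close>.\<close>
  proof (rule exI[of _ "\<lambda>k n. B2 (s n) (p2 k)"], intro allI conjI impI)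
    fix n x
    show "poly (s n) x = B2 (s n) (p2 n) * poly (p2 n) x
        + (if n \<ge> 1 then B2 (s n) (p2 (n - 1)) * poly (p2 (n - 1)) x else 0)
        + (if n \<ge> 2 then B2 (s n) (p2 (n - 2)) * poly (p2 (n - 2)) x else 0)"
    proof -
      \<comment> \<open>The cases 0 and 1 are separate because there the guarded terms are absent;
        from 2 on, \<open>low\<close> removes all but the last three terms.\<close>
      consider "n = 0" | "n = 1" | m where "n = Suc (Suc m)"
        by (metis One_nat_def not0_implies_Suc)
      then show ?thesis
      proof cases
        case 3
        have "(\<Sum>k<m. B2 (s n) (p2 k) * poly (p2 k) x) = 0"
          using 3 by (simp add: low)
        with exp[of n x] 3 show ?thesis by simp
      qed (use exp[of n x] in simp_all)
    qed
  next
    fix n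
    show "B2 (s n) (p2 n) = t n / r2 n"
      by (rule lead)
    show "B2 (s n) (p2 n) = t n / r (n + 1) * sqrt (K (n + 1) c c / K n c c)"
      using lead[of n] Kpos[of n] Kpos[of "Suc n"] rpos[of "Suc n"]
      by (simp add: r2_eq real_sqrt_divide)
  next
    fix n :: nat
    assume "n \<ge> 1"
    then show "B2 (s n) (p2 (n - 1)) = - sqrt (K (n - 1) c c / K n c c) *
          (d (n - 1) * (t n / r n)
           + e (n - 1) * (r n / r (n - 1)) *
             (M * poly (s n) c * poly (p (n - 1)) c
              + N * poly (pderiv (s n)) c * poly (pderiv (p (n - 1))) c))"
      using first[of "n - 1"] by simp
  next
    fix n :: nat
    assume "n \<ge> 2"
    then obtain m where "n = m + 2"
      using le_Suc_ex by (metis add.commute)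
    then show "B2 (s n) (p2 (n - 2)) = r (n - 1) / t n * sqrt (K (n - 2) c c / K (n - 1) c c)"
      using second[of m] by (simp add: r2_eq)
  qed
qed

end
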